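(* Let $G=(V(G),E(G))$ be a finite graph. For every real $q>1$, $w\ge 0$ and $B\in\mathbb R$, $$Z^{(2)}_G(q,w,B)=Z_G(\psi,\overline\psi),$$ where $\psi(+,+)=1+w$, $\psi(+,-)=\psi(-,+)=1$, $\psi(-,-)=1+\frac{w}{q-1}$, and $\overline\psi(+)=1$, $\overline\psi(-)=(q-1)e^{-B}$.
   Context: With $E(S)$ the set of edges of $G$ having both endpoints in $S\subseteq V(G)$, $$Z^{(2)}_G(q,w,B)=\sum_{S\subseteq V(G)}(1+w)^{|E(S)|}\Big(1+\frac{w}{q-1}\Big)^{|E(V(G)\setminus S)|}\big((q-1)e^{-B}\big)^{|V(G)|-|S|}.$$ The two-spin partition function is $$Z_G(\psi,\overline\psi)=\sum_{\sigma\in\{+,-\}^{V(G)}}\ \prod_{v\in V(G)}\overline\psi(\sigma_v)\prod_{\{u,v\}\in E(G)}\psi(\sigma_u,\sigma_v).$$ *)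

theory Defs
  imports Complex_Main "HOL-Library.FuncSet"
begin

text \<open>Graphs are simple: an edge is a set of two distinct vertices.\<close>

definition finite_graph :: "'v set \<Rightarrow> 'v set set \<Rightarrow> bool" where
  "finite_graph V E \<longleftrightarrow> finite V \<and> (\<forall>e\<in>E. e \<subseteq> V \<and> card e = 2)"

definition edges_within :: "'v set set \<Rightarrow> 'v set \<Rightarrow> 'v set set" where
  "edges_within E S = {e \<in> E. e \<subseteq> S}"

definition Z2 :: "'v set \<Rightarrow> 'v set set \<Rightarrow> real \<Rightarrow> real \<Rightarrow> real \<Rightarrow> real" where
  "Z2 V E q w B =
    (\<Sum>S\<in>Pow V. (1 + w) ^ card (edges_within E S)
      * (1 + w / (q - 1)) ^ card (edges_within E (V - S))
      * ((q - 1) * exp (- B)) ^ (card V - card S))"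

datatype spin = Plus | Minus

text \<open>The value \<open>\<psi> (\<sigma> u) (\<sigma> v)\<close> for the unordered edge \<open>{u, v}\<close>. It does not depend on
  the order of the endpoints, and so is uniquely determined, whenever \<open>\<psi>\<close> is symmetric; the
  definition is meant only for such \<open>\<psi>\<close>.\<close>

definition edge_weight ::
    "(spin \<Rightarrow> spin \<Rightarrow> real) \<Rightarrow> ('v \<Rightarrow> spin) \<Rightarrow> 'v set \<Rightarrow> real" where
  "edge_weight \<psi> \<sigma> e = (THE x. \<exists>u v. e = {u, v} \<and> x = \<psi> (\<sigma> u) (\<sigma> v))"

text \<open>Configurations are extensional functions on \<open>V\<close>, so that each map from \<open>V\<close> to spins
  is counted exactly once.\<close>

definition two_spin_Z ::
    "'v set \<Rightarrow> 'v set set \<Rightarrow> (spin \<Rightarrow> spin \<Rightarrow> real) \<Rightarrow> (spin \<Rightarrow> real) \<Rightarrow> real" where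
  "two_spin_Z V E \<psi> \<psi>' =
    (\<Sum>\<sigma> \<in> V \<rightarrow>\<^sub>E (UNIV :: spin set).
      (\<Prod>v\<in>V. \<psi>' (\<sigma> v)) * (\<Prod>e\<in>E. edge_weight \<psi> \<sigma> e))"

end

theory Submission
  imports Defs
begin

text \<open>A spin configuration on \<open>V\<close> is the same thing as the set \<open>S \<subseteq> V\<close> of its plus vertices, so both
  sides are sums over the same index set (\<open>bij_betw_spin_config\<close>) and it suffices to compare the
  summands. Since \<open>\<psi> Plus Minus = \<psi> Minus Plus = 1\<close>, only edges inside \<open>S\<close> and edges inside \<open>V - S\<close>
  contribute a factor other than \<open>1\<close>; an edge, having two distinct endpoints, is never of both
  kinds. Collecting equal factors gives the powers in \<open>Z2\<close> (\<open>prod_edge_weight_spin_config\<close>,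
  \<open>prod_vertex_weight_spin_config\<close>).\<close>

text \<open>The configuration on \<open>V\<close> whose set of plus vertices is \<open>S\<close>, with value \<open>undefined\<close> off \<open>V\<close>.\<close>

definition spin_config :: "'v set \<Rightarrow> 'v set \<Rightarrow> 'v \<Rightarrow> spin" where
  "spin_config V S = restrict (\<lambda>v. if v \<in> S then Plus else Minus) V"

lemma bij_betw_spin_config:
  "bij_betw (spin_config V) (Pow V) (V \<rightarrow>\<^sub>E (UNIV :: spin set))"
proof (rule bij_betw_byWitness[where f' = "\<lambda>\<sigma>. {v \<in> V. \<sigma> v = Plus}"])
  show "\<forall>S\<in>Pow V. {v \<in> V. spin_config V S v = Plus} = S"
    by (auto simp: spin_config_def split: if_splits)
  show "\<forall>\<sigma>\<in>V \<rightarrow>\<^sub>E (UNIV :: spin set). spin_config V {v \<in> V. \<sigma> v = Plus} = \<sigma>"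
  proof (intro ballI ext)
    fix \<sigma> :: "'a \<Rightarrow> spin" and v
    assume "\<sigma> \<in> V \<rightarrow>\<^sub>E UNIV"
    then have "\<sigma> v = undefined" if "v \<notin> V"
      using that by (rule PiE_arb)
    then show "spin_config V {v \<in> V. \<sigma> v = Plus} v = \<sigma> v"
      by (cases "\<sigma> v") (simp_all add: spin_config_def restrict_def)
  qed
  show "spin_config V ` Pow V \<subseteq> V \<rightarrow>\<^sub>E (UNIV :: spin set)"
    by (auto simp: spin_config_def)
  show "(\<lambda>\<sigma>. {v \<in> V. \<sigma> v = Plus}) ` (V \<rightarrow>\<^sub>E (UNIV :: spin set)) \<subseteq> Pow V"
    by auto
qed

lemma edge_weight_doubleton:
  assumes "\<And>s t. \<psi> s t = \<psi> t s"
  shows "edge_weight \<psi> \<sigma> {u, v} = \<psi> (\<sigma> u) (\<sigma> v)"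
  unfolding edge_weight_def
proof (rule the_equality)
  fix x
  assume "\<exists>a b. {u, v} = {a, b} \<and> x = \<psi> (\<sigma> a) (\<sigma> b)"
  then show "x = \<psi> (\<sigma> u) (\<sigma> v)"
    using assms by (auto simp: doubleton_eq_iff)
qed auto

lemma edge_weight_spin_config:
  assumes "e \<subseteq> V" and "card e = 2"
    and "\<psi> Plus Minus = 1" and "\<psi> Minus Plus = 1"
  shows "edge_weight \<psi> (spin_config V S) e =
    (if e \<subseteq> S then \<psi> Plus Plus else 1) * (if e \<subseteq> V - S then \<psi> Minus Minus else 1)"
proof -
  obtain u v where e: "e = {u, v}"
    using assms(2) by (auto simp: card_2_iff)
  have sym: "\<psi> s t = \<psi> t s" for s t
    using assms(3,4) by (cases s; cases t) auto
  show ?thesis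
    using assms(1,3,4) unfolding e edge_weight_doubleton[of \<psi>, OF sym]
    by (cases "u \<in> S"; cases "v \<in> S") (simp_all add: spin_config_def)
qed

lemma prod_edge_weight_spin_config:
  assumes "finite_graph V E"
    and "\<psi> Plus Minus = 1" and "\<psi> Minus Plus = 1"
  shows "(\<Prod>e\<in>E. edge_weight \<psi> (spin_config V S) e) =
    \<psi> Plus Plus ^ card (edges_within E S) * \<psi> Minus Minus ^ card (edges_within E (V - S))"
proof -
  have "E \<subseteq> Pow V" "finite V"
    using assms(1) by (auto simp: finite_graph_def)
  then have "finite E"
    by (meson finite_Pow_iff finite_subset)
  then have collect: "(\<Prod>e\<in>E. if e \<subseteq> T then c else 1) = c ^ card (edges_within E T)"
    for T and c :: real
    by (simp add: edges_within_def flip: prod.inter_filter)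
  have "(\<Prod>e\<in>E. edge_weight \<psi> (spin_config V S) e) =
    (\<Prod>e\<in>E. (if e \<subseteq> S then \<psi> Plus Plus else 1) * (if e \<subseteq> V - S then \<psi> Minus Minus else 1))"
    using assms by (intro prod.cong edge_weight_spin_config) (auto simp: finite_graph_def)
  then show ?thesis
    by (simp only: prod.distrib collect)
qed

lemma prod_vertex_weight_spin_config:
  fixes \<psi>' :: "spin \<Rightarrow> real"
  assumes "finite V" and "S \<subseteq> V" and "\<psi>' Plus = 1"
  shows "(\<Prod>v\<in>V. \<psi>' (spin_config V S v)) = \<psi>' Minus ^ (card V - card S)"
proof -
  have "(\<Prod>v\<in>V. \<psi>' (spin_config V S v)) = (\<Prod>v\<in>V - S. \<psi>' Minus)"
    using assms by (intro prod.mono_neutral_cong_right) (auto simp: spin_config_def)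
  then show ?thesis
    using assms by (simp add: card_Diff_subset finite_subset)
qed

theorem theorem1p6:
  fixes V :: "'v set" and E :: "'v set set"
    and q w B :: real
    and \<psi> :: "spin \<Rightarrow> spin \<Rightarrow> real" and \<psi>' :: "spin \<Rightarrow> real"
  assumes "finite_graph V E"
    and "q > 1" and "w \<ge> 0"
    and "\<psi> Plus Plus = 1 + w"
    and "\<psi> Plus Minus = 1" and "\<psi> Minus Plus = 1"
    and "\<psi> Minus Minus = 1 + w / (q - 1)"
    and "\<psi>' Plus = 1"
    and "\<psi>' Minus = (q - 1) * exp (- B)"
  shows "Z2 V E q w B = two_spin_Z V E \<psi> \<psi>'"
proof -
  have fin: "finite V"
    using assms(1) by (simp add: finite_graph_def)
  have "two_spin_Z V E \<psi> \<psi>' =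
    (\<Sum>S\<in>Pow V. (\<Prod>v\<in>V. \<psi>' (spin_config V S v)) * (\<Prod>e\<in>E. edge_weight \<psi> (spin_config V S) e))"
    unfolding two_spin_Z_def by (rule sum.reindex_bij_betw[OF bij_betw_spin_config, symmetric])
  also have "\<dots> = Z2 V E q w B"
    unfolding Z2_def
  proof (rule sum.cong)
    fix S
    assume "S \<in> Pow V"
    then have "S \<subseteq> V" by simp
    show "(\<Prod>v\<in>V. \<psi>' (spin_config V S v)) * (\<Prod>e\<in>E. edge_weight \<psi> (spin_config V S) e) =
      (1 + w) ^ card (edges_within E S) * (1 + w / (q - 1)) ^ card (edges_within E (V - S))
        * ((q - 1) * exp (- B)) ^ (card V - card S)"
      unfolding prod_vertex_weight_spin_config[of V S \<psi>', OF fin \<open>S \<subseteq> V\<close> assms(8)]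
        prod_edge_weight_spin_config[of V E \<psi> S, OF assms(1,5,6)] assms(4,7,9)
      by (simp only: mult_ac)
  qed simp
  finally show ?thesis by simp
qed

end
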